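(* Let $1<p,q<\infty$. Let $\mu$ be a finite Borel measure on $G$ and let $x\in G$. Then a Borel measure $\nu$ on $\widehat{G}$ is a $(p,q)$-frame measure for $\mu$ if and only if $\nu$ is a $(p,q)$-frame measure for $\delta_x\ast\mu$, with the same frame bounds.
   Context: $G$ is a locally compact Hausdorff abelian (LCA) group, written additively, which is metrizable and a countable union of compact sets; $\widehat{G}$ is its dual group (continuous characters, written additively), and $\langle x,\gamma\rangle$ denotes the value of $\gamma\in\widehat{G}$ at $x\in G$. Measures are non-negative. $\delta_x$ is the Dirac measure at $x$, and $(\delta_x\ast\mu)(E)=\mu(E-x)$ for Borel $E\subset G$. For a finite Borel measure $\mu$ on $G$ and $f\in L^1(\mu)$, $\widehat{fd\mu}(\gamma)=\int_G f(x)\overline{\langle x,\gamma\rangle}\,d\mu(x)$ for $\gamma\in\widehat{G}$. A Borel measure $\nu$ on $\widehat{G}$ is a $(p,q)$-frame measure for $\mu$ with frame bounds $A,B$ if $0<A\le B<\infty$ and $A\|f\|_{L^p(\mu)}^q\le\|\widehat{fd\mu}\|_{L^q(\nu)}^q\le B\|f\|_{L^p(\mu)}^q$ for all $f\in L^p(\mu)$. *)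

theory Defs
  imports "HOL-Analysis.Analysis"
begin

section \<open>The dual group of a topological abelian group\<close>

typedef (overloaded) ('a :: topological_ab_group_add) dual_group =
    "{\<gamma> :: 'a \<Rightarrow> complex. continuous_on UNIV \<gamma> \<and> (\<forall>x. norm (\<gamma> x) = 1) \<and> (\<forall>x y. \<gamma> (x + y) = \<gamma> x * \<gamma> y)}"
  morphisms char_val Abs_dual_group
  by (intro exI[of _ "\<lambda>_. 1"]) auto

setup_lifting type_definition_dual_group

text \<open>The group operation is pointwise multiplication of characters, written additively.\<close>

instantiation dual_group :: (topological_ab_group_add) ab_group_add
begin

lift_definition zero_dual_group :: "'a dual_group" is "\<lambda>_. 1"
  by auto

lift_definition plus_dual_group :: "'a dual_group \<Rightarrow> 'a dual_group \<Rightarrow> 'a dual_group"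
  is "\<lambda>\<gamma> \<eta> x. \<gamma> x * \<eta> x"
  by (auto intro!: continuous_intros simp: norm_mult)

lift_definition uminus_dual_group :: "'a dual_group \<Rightarrow> 'a dual_group"
  is "\<lambda>\<gamma> x. cnj (\<gamma> x)"
  by (auto intro!: continuous_intros)

definition minus_dual_group :: "'a dual_group \<Rightarrow> 'a dual_group \<Rightarrow> 'a dual_group"
  where "minus_dual_group \<gamma> \<eta> = \<gamma> + (- \<eta>)"

instance
proof
  fix a b c :: "'a dual_group"
  show "a + b + c = a + (b + c)" by transfer (auto simp: mult.assoc)
  show "a + b = b + a" by transfer (auto simp: mult.commute)
  show "0 + a = a" by transfer auto
  show "- a + a = 0"
    by transfer (auto simp: fun_eq_iff mult.commute[of "cnj _"] complex_norm_square[symmetric])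
  show "a - b = a + - b" by (rule minus_dual_group_def)
qed

end

text \<open>The topology is the compact-open topology.\<close>

instantiation dual_group :: (topological_ab_group_add) topological_space
begin

definition open_dual_group :: "'a dual_group set \<Rightarrow> bool" where
  "open_dual_group =
     generate_topology {{\<gamma>. char_val \<gamma> ` K \<subseteq> U} | K U. compact K \<and> open U}"

instance
  by standard (auto simp: open_dual_group_def intro: generate_topology.intros)

end

section \<open>\<open>L\<^sup>p\<close> norms\<close>

text \<open>Real powers on \<open>[0, \<infinity>]\<close>; only meant for exponents \<open>r > 0\<close>.\<close>

definition ennreal_powr :: "ennreal \<Rightarrow> real \<Rightarrow> ennreal" where
  "ennreal_powr a r = (if a = \<infinity> then \<infinity> else ennreal (enn2real a powr r))"

text \<open>The norm is extended-valued, so it is also meaningful (and infinite) outside of \<open>L\<^sup>p\<close>.\<close>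

definition Lp_norm :: "real \<Rightarrow> 'b measure \<Rightarrow> ('b \<Rightarrow> complex) \<Rightarrow> ennreal" where
  "Lp_norm p M f = ennreal_powr (\<integral>\<^sup>+x. ennreal (norm (f x) powr p) \<partial>M) (1 / p)"

definition Lp :: "real \<Rightarrow> 'b measure \<Rightarrow> ('b \<Rightarrow> complex) set" where
  "Lp p M = {f \<in> borel_measurable M. Lp_norm p M f < \<infinity>}"

section \<open>Frame measures\<close>

text \<open>The Fourier transform of the complex measure \<open>f d\<mu>\<close>.\<close>

definition fourier ::
    "('a :: topological_ab_group_add) measure \<Rightarrow> ('a \<Rightarrow> complex) \<Rightarrow> 'a dual_group \<Rightarrow> complex" where
  "fourier \<mu> f \<gamma> = (LINT x|\<mu>. f x * cnj (char_val \<gamma> x))"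

definition frame_measure ::
    "real \<Rightarrow> real \<Rightarrow> ('a :: topological_ab_group_add) measure \<Rightarrow> 'a dual_group measure
      \<Rightarrow> real \<Rightarrow> real \<Rightarrow> bool" where
  "frame_measure p q \<mu> \<nu> A B \<longleftrightarrow>
     0 < A \<and> A \<le> B \<and>
     (\<forall>f \<in> Lp p \<mu>.
        ennreal A * ennreal_powr (Lp_norm p \<mu> f) q
          \<le> ennreal_powr (Lp_norm q \<nu> (fourier \<mu> f)) q \<and>
        ennreal_powr (Lp_norm q \<nu> (fourier \<mu> f)) q
          \<le> ennreal B * ennreal_powr (Lp_norm p \<mu> f) q)"

section \<open>Convolution with a Dirac measure\<close>

text \<open>
  The convolution in \<open>HOL-Probability\<close> is restricted to Euclidean spaces. Here \<open>\<delta>\<^sub>x * \<mu>\<close> is the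
  image of \<open>\<mu>\<close> under translation by \<open>x\<close>; \<open>emeasure_dirac_conv\<close> is the formula
  \<open>(\<delta>\<^sub>x * \<mu>)(E) = \<mu>(E - x)\<close>, with \<open>E - x\<close> written as an image.
\<close>

definition dirac_conv :: "'a \<Rightarrow> ('a :: topological_ab_group_add) measure \<Rightarrow> 'a measure" where
  "dirac_conv x \<mu> = distr \<mu> borel (\<lambda>y. x + y)"

lemma sets_dirac_conv [simp]: "sets (dirac_conv x \<mu>) = sets borel"
  by (simp add: dirac_conv_def)

lemma measurable_translation_borel:
  fixes x :: "'a :: topological_ab_group_add"
  shows "(\<lambda>y. x + y) \<in> borel_measurable borel"
  by (intro borel_measurable_continuous_onI continuous_intros)

lemma emeasure_dirac_conv:
  fixes x :: "'a :: topological_ab_group_add"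
  assumes "sets \<mu> = sets borel" and "E \<in> sets borel"
  shows "emeasure (dirac_conv x \<mu>) E = emeasure \<mu> ((\<lambda>y. y - x) ` E)"
proof -
  have "(\<lambda>y. x + y) \<in> measurable \<mu> borel"
    using measurable_translation_borel measurable_cong_sets[OF assms(1) refl] by blast
  moreover have "(\<lambda>y. x + y) -` E \<inter> space \<mu> = (\<lambda>y. y - x) ` E"
    using sets_eq_imp_space_eq[OF assms(1)] by (force simp: image_iff)
  ultimately show ?thesis
    unfolding dirac_conv_def using assms(2) by (simp add: emeasure_distr)
qed

end

theory Submission
  imports Defs
begin

text \<open>Substituting \<open>x + y\<close> for \<open>y\<close> turns integrals against
  \<open>dirac_conv x \<mu>\<close> into integrals against \<mu>. Hence composition with the
  translation preserves the p-norm (\<open>Lp_norm_distr\<close>). As characters are multiplicative,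
  it changes the Fourier transform only by the factor \<open>cnj (char_val \<gamma> x)\<close>
  (\<open>fourier_dirac_conv\<close>). This factor has modulus 1, so the q-norm over \<nu> does not
  see it (\<open>Lp_norm_cong\<close>). Each frame inequality for f and the translated measure is
  thus the one for the translate of f and \<mu>, with the same A and B. This gives one implication;
  the converse is the same implication for the translation by \<open>- x\<close>, which undoes the
  first (\<open>dirac_conv_uminus\<close>).\<close>

lemma norm_char_val [simp]: "norm (char_val \<gamma> x) = 1"
  using char_val[of \<gamma>] by simp

lemma char_val_add: "char_val \<gamma> (x + y) = char_val \<gamma> x * char_val \<gamma> y"
  using char_val[of \<gamma>] by simp

lemma continuous_on_char_val: "continuous_on UNIV (char_val \<gamma>)"
  using char_val[of \<gamma>] by simp

lemma Lp_norm_distr: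
  assumes "T \<in> measurable M N" and "f \<in> borel_measurable N"
  shows "Lp_norm p (distr M N T) f = Lp_norm p M (f \<circ> T)"
  unfolding Lp_norm_def comp_def using assms by (subst nn_integral_distr) simp_all

lemma Lp_norm_cong:
  assumes "\<And>x. norm (f x) = norm (g x)"
  shows "Lp_norm p M f = Lp_norm p M g"
  by (simp add: Lp_norm_def assms)

lemma measurable_translation:
  fixes x :: "'a :: topological_ab_group_add"
  assumes "sets \<mu> = sets borel"
  shows "(\<lambda>y. x + y) \<in> measurable \<mu> borel"
  using measurable_translation_borel measurable_cong_sets[OF assms refl] by blast

lemma dirac_conv_uminus:
  fixes x :: "'a :: topological_ab_group_add"
  assumes "sets \<mu> = sets borel"
  shows "dirac_conv (- x) (dirac_conv x \<mu>) = \<mu>"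
proof -
  have "dirac_conv (- x) (dirac_conv x \<mu>) = distr \<mu> borel ((\<lambda>y. - x + y) \<circ> (\<lambda>y. x + y))"
    unfolding dirac_conv_def
    by (rule distr_distr[OF measurable_translation_borel measurable_translation[OF assms]])
  \<comment> \<open>The target \<open>borel\<close> may be replaced by \<mu>, since an image measure
    depends on its target only through the sigma-algebra. What remains is the image under the
    identity.\<close>
  also have "\<dots> = distr \<mu> \<mu> (\<lambda>y. y)"
    by (rule distr_cong) (simp_all add: assms)
  finally show ?thesis by simp
qed

text \<open>Multiplicativity splits the character at \<open>x + y\<close>, and its value at
  \<open>x\<close> is a constant that leaves the integral. Integrability of f is not assumed: if it
  fails, both integrals take the default value 0, as the factor is nonzero.\<close>

lemma fourier_dirac_conv:
  assumes "sets \<mu> = sets borel" and f: "f \<in> borel_measurable borel"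
  shows "fourier (dirac_conv x \<mu>) f \<gamma> = cnj (char_val \<gamma> x) * fourier \<mu> (f \<circ> (\<lambda>y. x + y)) \<gamma>"
proof -
  have "(\<lambda>y. cnj (char_val \<gamma> y)) \<in> borel_measurable borel"
    by (intro borel_measurable_continuous_onI continuous_intros continuous_on_char_val)
  then have "fourier (dirac_conv x \<mu>) f \<gamma> = (LINT y|\<mu>. f (x + y) * cnj (char_val \<gamma> (x + y)))"
    unfolding fourier_def dirac_conv_def
    by (intro integral_distr[OF measurable_translation[OF assms(1)]] borel_measurable_times f)
  also have "\<dots> = (LINT y|\<mu>. cnj (char_val \<gamma> x) * (f (x + y) * cnj (char_val \<gamma> y)))"
    by (simp add: char_val_add mult_ac)
  finally show ?thesis by (simp add: fourier_def)
qed

text \<open>One implication suffices because \<mu> and \<open>x\<close> are arbitrary: the lemma can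
  be applied again to a measure that is already translated.\<close>

lemma frame_measure_dirac_conv:
  assumes \<mu>: "sets \<mu> = sets borel" and frame: "frame_measure p q \<mu> \<nu> A B"
  shows "frame_measure p q (dirac_conv x \<mu>) \<nu> A B"
proof -
  let ?\<tau> = "\<lambda>y. x + y"
  have \<tau>: "?\<tau> \<in> measurable \<mu> borel"
    by (rule measurable_translation[OF \<mu>])
  \<comment> \<open>The frame bounds of \<mu> will be used at the test function
    \<open>f \<circ> ?\<tau>\<close>; the two norm identities carry them back to f.\<close>
  have "f \<circ> ?\<tau> \<in> Lp p \<mu> \<and> Lp_norm p (dirac_conv x \<mu>) f = Lp_norm p \<mu> (f \<circ> ?\<tau>) \<and>
      Lp_norm q \<nu> (fourier (dirac_conv x \<mu>) f) = Lp_norm q \<nu> (fourier \<mu> (f \<circ> ?\<tau>))"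
    if "f \<in> Lp p (dirac_conv x \<mu>)" for f
  proof -
    have f: "f \<in> borel_measurable borel"
      using that by (simp add: Lp_def dirac_conv_def)
    have norm: "Lp_norm p (dirac_conv x \<mu>) f = Lp_norm p \<mu> (f \<circ> ?\<tau>)"
      unfolding dirac_conv_def by (rule Lp_norm_distr[OF \<tau> f])
    moreover have "f \<circ> ?\<tau> \<in> Lp p \<mu>"
      using that norm measurable_comp[OF \<tau> f] by (simp add: Lp_def)
    moreover have "Lp_norm q \<nu> (fourier (dirac_conv x \<mu>) f) = Lp_norm q \<nu> (fourier \<mu> (f \<circ> ?\<tau>))"
      by (rule Lp_norm_cong) (simp add: fourier_dirac_conv[OF \<mu> f] norm_mult)
    ultimately show ?thesis by blast
  qed
  then show ?thesis
    using frame unfolding frame_measure_def by simp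
qed

theorem theorem2p3:
  fixes \<mu> :: "'a :: {topological_ab_group_add, t2_space} measure"
    and \<nu> :: "'a dual_group measure"
    and x :: 'a
    and p q A B :: real
  assumes "locally_compact_space (euclidean :: 'a topology)"
    and "metrizable_space (euclidean :: 'a topology)"
    and "\<exists>K :: nat \<Rightarrow> 'a set. (\<forall>n. compact (K n)) \<and> (\<Union>n. K n) = UNIV"
    and "1 < p" and "1 < q"
    and "sets \<mu> = sets borel" and "finite_measure \<mu>"
    and "sets \<nu> = sets borel"
  shows "frame_measure p q \<mu> \<nu> A B \<longleftrightarrow> frame_measure p q (dirac_conv x \<mu>) \<nu> A B"
  \<comment> \<open>The second instance translates back by \<open>- x\<close>, and its conclusion is
    about \<mu> by \<open>dirac_conv_uminus\<close>.\<close>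
  using frame_measure_dirac_conv[of \<mu> p q \<nu> A B x]
    frame_measure_dirac_conv[of "dirac_conv x \<mu>" p q \<nu> A B "- x"]
    dirac_conv_uminus[of \<mu> x] assms(6)
  by auto

end
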